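(* Assume (A1), (A2) and the Lipschitz conditions (L1), (L2) stated in the context. Let $\theta_n^{l,h}$ and $\theta_n^{l,r}$ ($n=1,\dots,M$) be the Stein variational gradient descent samples generated, from the same initial samples $\theta_n^{0,h}=\theta_n^{0,r}=\theta_n$, with the potentials $\eta_y^h$ and $\eta_y^r$ and step sizes $\alpha_i^h$ and $\alpha_i^r$ respectively, and assume that $\alpha_i^h=\alpha_i^r$ for $i=0,\dots,l$. Then, for some constants $C_i$, $i=0,\dots,l$, one has for all $n=1,\dots,M$ $$\|\theta_n^{l+1,h}-\theta_n^{l+1,r}\|_1\le\sum_{i=0}^{l}C_i\,\frac1M\sum_{m=1}^M\|\nabla_\theta e_r^\eta(\theta_m^{i,r})\|_1,$$ where $e_r^\eta(\theta)=\eta_y^h(\theta)-\eta_y^r(\theta)$.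
   Context: Setting. $V$ is a real Hilbert space with dual $V'$; $\Theta\subset\mathbb R^d$ is the parameter set and $p_0$ is a positive differentiable prior density on $\Theta$; for each $\theta\in\Theta$, $A(\cdot,\cdot;\theta):V\times V\to\mathbb R$ is bilinear and $F(\cdot;\theta):V\to\mathbb R$ is linear. $\mathcal O=(o_1,\dots,o_s)$ with $o_i\in V'$; $y\in\mathbb R^s$; $\Gamma\in\mathbb R^{s\times s}$ is symmetric positive definite; $\eta_y(u)=\frac12(y-\mathcal O(u))^T\Gamma^{-1}(y-\mathcal O(u))$ for $u\in V$. Assumptions. (A1) For every $\theta\in\Theta$ there are $\alpha(\theta)>0$, $\gamma(\theta)>0$ with $\alpha(\theta)\|w\|_V^2\le A(w,w;\theta)$ and $A(w,v;\theta)\le\gamma(\theta)\|w\|_V\|v\|_V$ for all $w,v\in V$, and $\|F(\cdot;\theta)\|_{V'}<\infty$. (A2) $A(\cdot,\cdot;\theta)$ and $F(\cdot;\theta)$ are continuously differentiable in $\theta$ at every $\theta\in\Theta$ (as maps into the Banach spaces of bounded bilinear forms on $V$ and $V'$), and for each $j=1,\dots,d$ there is $0<\rho_j(\theta)<\infty$ with $\partial_{\theta_j}A(w,v;\theta)\le\rho_j(\theta)\|w\|_V\|v\|_V$ for all $w,v\in V$, and $\|\partial_{\theta_j}F(\cdot;\theta)\|_{V'}<\infty$. Potentials. $V_h\subset V$ is a finite-dimensional subspace and $V_r\subset V_h$ a subspace (independent of $\theta$); $u_h(\theta)\in V_h$ solves $A(u_h,v;\theta)=F(v;\theta)$ for all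 $v\in V_h$, and $u_r(\theta)\in V_r$ solves $A(u_r,v;\theta)=F(v;\theta)$ for all $v\in V_r$; $\eta_y^h(\theta)=\eta_y(u_h(\theta))$, $\eta_y^r(\theta)=\eta_y(u_r(\theta))$. Lipschitz conditions. There are constants $C_p,C_\eta$ such that for all $\theta,\theta'\in\Theta$: (L1) $\left\|\frac{\nabla_\theta p_0(\theta)}{p_0(\theta)}-\frac{\nabla_\theta p_0(\theta')}{p_0(\theta')}\right\|_1\le C_p\|\theta-\theta'\|_1$; (L2) $\|\nabla_\theta\eta_y^h(\theta)-\nabla_\theta\eta_y^h(\theta')\|_1\le C_\eta\|\theta-\theta'\|_1$. Here $\|\cdot\|_1$ is the $\ell_1$-norm on $\mathbb R^d$. Samples. The kernel is $k(\theta,\theta')=\exp(-\frac1\kappa\|\theta-\theta'\|_2^2)$ with a fixed scaling factor $\kappa>0$. For $\bullet\in\{h,r\}$ and $i\ge0$, $$\theta_n^{i+1,\bullet}=\theta_n^{i,\bullet}+\alpha_i^\bullet\,\frac1M\sum_{m=1}^M\Big(\nabla_\theta\log p_y^\bullet(\theta_m^{i,\bullet})\,k(\theta_m^{i,\bullet},\theta_n^{i,\bullet})+\nabla_\theta k(\theta_m^{i,\bullet},\theta_n^{i,\bullet})\Big),\quad n=1,\dots,M,$$ where $\nabla_\theta k$ is the gradient in the first argument, $\alpha_i^\bullet>0$ are step sizes, and $\nabla_\theta\log p_y^\bullet(\theta)=-\nabla_\theta\eta_y^\bullet(\theta)+\frac{\nabla_\theta p_0(\theta)}{p_0(\theta)}$.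 All samples are assumed to lie in $\Theta$. *)

theory Defs
  imports "HOL-Analysis.Analysis"
begin

section \<open>Calculus on a parameter set\<close>

definition norm1 :: "real^'d \<Rightarrow> real" where
  "norm1 x = (\<Sum>j\<in>UNIV. \<bar>x $ j\<bar>)"

text \<open>The data are given on the parameter set only, so derivatives are taken within that set. For
  the gradient to be well defined, derivatives within the set have to be unique; this
  excludes, for instance, sets with isolated points, and holds for open sets and for boxes, as the
  two lemmas show.\<close>

definition unique_derivatives :: "(real^'d) set \<Rightarrow> bool" where
  "unique_derivatives S \<longleftrightarrow>
     (\<forall>x\<in>S. \<forall>f'. ((\<lambda>_. 0::real) has_derivative f') (at x within S) \<longrightarrow> f' = (\<lambda>_. 0))"

lemma unique_derivatives_open:
  fixes S :: "(real^'d) set"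
  assumes "open S"
  shows "unique_derivatives S"
  unfolding unique_derivatives_def
proof (intro ballI allI impI)
  fix x and f' :: "real^'d \<Rightarrow> real"
  assume "x \<in> S" and "((\<lambda>_. 0) has_derivative f') (at x within S)"
  then have "((\<lambda>_. 0) has_derivative f') (at x)"
    using assms by (simp only: at_within_open)
  then show "f' = (\<lambda>_. 0)"
    by (rule has_derivative_unique[OF _ has_derivative_const])
qed

lemma unique_derivatives_cbox:
  fixes a b :: "real^'d"
  assumes "\<And>i. i \<in> Basis \<Longrightarrow> a \<bullet> i < b \<bullet> i"
  shows "unique_derivatives (cbox a b)"
  unfolding unique_derivatives_def
proof (intro ballI allI impI)
  fix x and f' :: "real^'d \<Rightarrow> real"
  assume x: "x \<in> cbox a b" and f': "((\<lambda>_. 0) has_derivative f') (at x within cbox a b)"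
  show "f' = (\<lambda>_. 0)"
    by (rule frechet_derivative_unique_within_closed_interval[OF assms x f' has_derivative_const])
qed

definition grad_within :: "(real^'d) set \<Rightarrow> (real^'d \<Rightarrow> real) \<Rightarrow> real^'d \<Rightarrow> real^'d" where
  "grad_within S f x = (\<chi> j. frechet_derivative f (at x within S) (axis j 1))"

definition C1_on :: "(real^'d) set \<Rightarrow> (real^'d \<Rightarrow> 'b::real_normed_vector) \<Rightarrow> bool" where
  "C1_on S G \<longleftrightarrow> (\<exists>G' :: real^'d \<Rightarrow> ((real^'d) \<Rightarrow>\<^sub>L 'b).
     (\<forall>x\<in>S. (G has_derivative blinfun_apply (G' x)) (at x within S)) \<and> continuous_on S G')"

section \<open>Variational problem and data misfit\<close>

text \<open>A bounded bilinear form (resp. a bounded linear functional) on a Hilbert space as an element of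
  the Banach space of all of them. The constructor \<open>Blinfun\<close> is meaningful on bounded linear maps only.\<close>

definition form_blinfun ::
    "('v::real_normed_vector \<Rightarrow> 'v \<Rightarrow> real) \<Rightarrow> 'v \<Rightarrow>\<^sub>L 'v \<Rightarrow>\<^sub>L real" where
  "form_blinfun a = Blinfun (\<lambda>w. Blinfun (a w))"

definition coercive_continuous ::
    "('p \<Rightarrow> 'v::real_normed_vector \<Rightarrow> 'v \<Rightarrow> real) \<Rightarrow> ('p \<Rightarrow> 'v \<Rightarrow> real) \<Rightarrow> 'p set \<Rightarrow> bool" where
  "coercive_continuous A F \<Theta> \<longleftrightarrow>
     (\<forall>\<theta>\<in>\<Theta>. (\<exists>\<alpha>>0. \<exists>\<gamma>>0. \<forall>w v.
          \<alpha> * (norm w)\<^sup>2 \<le> A \<theta> w w \<and> A \<theta> w v \<le> \<gamma> * norm w * norm v) \<and>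
        bounded_linear (F \<theta>))"

definition smooth_parametric ::
    "(real^'d \<Rightarrow> 'v::real_normed_vector \<Rightarrow> 'v \<Rightarrow> real) \<Rightarrow> (real^'d \<Rightarrow> 'v \<Rightarrow> real)
     \<Rightarrow> (real^'d) set \<Rightarrow> bool" where
  "smooth_parametric A F \<Theta> \<longleftrightarrow>
     C1_on \<Theta> (\<lambda>\<theta>. form_blinfun (A \<theta>)) \<and> C1_on \<Theta> (\<lambda>\<theta>. Blinfun (F \<theta>)) \<and>
     (\<forall>\<theta>\<in>\<Theta>. \<forall>j.
        (\<exists>\<rho>>0. \<forall>w v. grad_within \<Theta> (\<lambda>t. A t w v) \<theta> $ j \<le> \<rho> * norm w * norm v) \<and>
        bounded_linear (\<lambda>v. grad_within \<Theta> (\<lambda>t. F t v) \<theta> $ j))"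

definition galerkin_solution ::
    "('v \<Rightarrow> 'v \<Rightarrow> real) \<Rightarrow> ('v \<Rightarrow> real) \<Rightarrow> 'v set \<Rightarrow> 'v \<Rightarrow> bool" where
  "galerkin_solution a f W u \<longleftrightarrow> u \<in> W \<and> (\<forall>v\<in>W. a u v = f v)"

definition symmetric_pos_def :: "real^'s^'s \<Rightarrow> bool" where
  "symmetric_pos_def G \<longleftrightarrow> transpose G = G \<and> (\<forall>x. x \<noteq> 0 \<longrightarrow> x \<bullet> (G *v x) > 0)"

definition misfit ::
    "('s::finite \<Rightarrow> 'v::real_normed_vector \<Rightarrow>\<^sub>L real) \<Rightarrow> real^'s^'s \<Rightarrow> real^'s \<Rightarrow> 'v \<Rightarrow> real" where
  "misfit obs \<Gamma> y u =
     (let r = y - (\<chi> i. blinfun_apply (obs i) u) in 1/2 * (r \<bullet> (matrix_inv \<Gamma> *v r)))"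

definition prior_density :: "(real^'d \<Rightarrow> real) \<Rightarrow> (real^'d) set \<Rightarrow> bool" where
  "prior_density p \<Theta> \<longleftrightarrow>
     (\<forall>\<theta>\<in>\<Theta>. p \<theta> > 0) \<and> p differentiable_on \<Theta> \<and>
     set_integrable lebesgue \<Theta> p \<and> (LINT \<theta>:\<Theta>|lebesgue. p \<theta>) = 1"

section \<open>Stein variational gradient descent\<close>

definition score_prior :: "(real^'d) set \<Rightarrow> (real^'d \<Rightarrow> real) \<Rightarrow> real^'d \<Rightarrow> real^'d" where
  "score_prior \<Theta> p \<theta> = (1 / p \<theta>) *\<^sub>R grad_within \<Theta> p \<theta>"

text \<open>Gradient of the logarithm of the posterior density, which is proportional to
  \<open>exp (- \<eta> \<theta>) * p \<theta>\<close>.\<close>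

definition score_posterior ::
    "(real^'d) set \<Rightarrow> (real^'d \<Rightarrow> real) \<Rightarrow> (real^'d \<Rightarrow> real) \<Rightarrow> real^'d \<Rightarrow> real^'d" where
  "score_posterior \<Theta> p \<eta> \<theta> = - grad_within \<Theta> \<eta> \<theta> + score_prior \<Theta> p \<theta>"

definition gauss_kernel :: "real \<Rightarrow> real^'d \<Rightarrow> real^'d \<Rightarrow> real" where
  "gauss_kernel \<kappa> x x' = exp (- (1 / \<kappa>) * (norm (x - x'))\<^sup>2)"

text \<open>\<open>th i n\<close> is sample number \<open>n \<in> {1..M}\<close> at iteration \<open>i\<close>, and \<open>s\<close> is the score of the target
  density.\<close>

definition svgd_samples ::
    "real \<Rightarrow> nat \<Rightarrow> (nat \<Rightarrow> real) \<Rightarrow> (real^'d \<Rightarrow> real^'d) \<Rightarrow> (nat \<Rightarrow> nat \<Rightarrow> real^'d) \<Rightarrow> bool" where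
  "svgd_samples \<kappa> M \<alpha> s th \<longleftrightarrow>
     (\<forall>i. \<forall>n\<in>{1..M}. th (Suc i) n = th i n + \<alpha> i *\<^sub>R ((1 / real M) *\<^sub>R
        (\<Sum>m=1..M. gauss_kernel \<kappa> (th i m) (th i n) *\<^sub>R s (th i m) +
                    grad_within UNIV (\<lambda>x. gauss_kernel \<kappa> x (th i n)) (th i m))))"

end

(* Galerkin solutions in a finite-dimensional space depend differentiably on the parameter: by
   coercivity the linearised equation has a solution, and its defect is of second order. Hence the
   gradient of the difference of the potentials is the difference of the scores, up to sign. The
   Gaussian kernel and its gradient are globally Lipschitz and the kernel is bounded by 1, so one
   descent step amplifies the largest deviation of the samples by at most a factor 1 + O(alpha_i) and
   adds alpha_i times the mean error of the score at the perturbed samples; iterating gives the bound. *)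

theory Submission
  imports Defs
begin

section \<open>The l1-norm and its comparison with the Euclidean norm\<close>

lemma norm1_nonneg: "norm1 x \<ge> 0"
  by (simp add: norm1_def sum_nonneg)

lemma norm1_minus: "norm1 (- x) = norm1 x"
  by (simp add: norm1_def)

lemma norm1_add_le: "norm1 (x + y) \<le> norm1 x + norm1 y"
  by (simp add: norm1_def sum.distrib[symmetric] sum_mono)

lemma norm1_add4_le: "norm1 (p + q + r + t) \<le> norm1 p + norm1 q + norm1 r + norm1 t"
  using norm1_add_le[of "p + q + r" t] norm1_add_le[of "p + q" r] norm1_add_le[of p q] by linarith

lemma norm1_diff_le: "norm1 (x - y) \<le> norm1 x + norm1 y"
  using norm1_add_le[of x "- y"] by (simp add: norm1_minus)

lemma norm1_scaleR: "norm1 (c *\<^sub>R x) = \<bar>c\<bar> * norm1 x"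
  by (simp add: norm1_def sum_distrib_left abs_mult)

lemma norm1_sum_le: "norm1 (\<Sum>i\<in>I. f i) \<le> (\<Sum>i\<in>I. norm1 (f i))"
proof (induction I rule: infinite_finite_induct)
  case (insert i I)
  then show ?case
    using norm1_add_le[of "f i" "\<Sum>i\<in>I. f i"] by simp
qed (simp_all add: norm1_def)

lemma norm_le_norm1: "norm x \<le> norm1 x"
  unfolding norm1_def by (rule norm_le_l1_cart)

lemma norm1_le_card_norm: "norm1 (x :: real^'d) \<le> real CARD('d) * norm x"
  unfolding norm1_def
  using sum_bounded_above[of "UNIV :: 'd set" "\<lambda>j. \<bar>x $ j\<bar>" "norm x"]
  by (simp add: component_le_norm_cart)

section \<open>Gradients within the parameter set\<close>

text \<open>\<open>unique_derivatives\<close> speaks of the zero function only; the difference of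
  two candidate derivatives of \<open>f\<close> is a derivative of \<open>f - f\<close>, which
  reduces the general case to it.\<close>

lemma unique_derivatives_eq:
  fixes f :: "real^'d \<Rightarrow> real"
  assumes "unique_derivatives S" "x \<in> S"
    and f': "(f has_derivative f') (at x within S)"
    and f'': "(f has_derivative f'') (at x within S)"
  shows "f' = f''"
proof -
  have "((\<lambda>_. 0) has_derivative (\<lambda>h. f' h - f'' h)) (at x within S)"
    using has_derivative_diff[OF f' f''] by simp
  then have "(\<lambda>h. f' h - f'' h) = (\<lambda>_. 0)"
    using assms(1,2) by (auto simp: unique_derivatives_def)
  then show ?thesis
    by (metis eq_iff_diff_eq_0 ext)
qed

lemma grad_within_eq:
  assumes "unique_derivatives S" "x \<in> S" "(f has_derivative f') (at x within S)"
  shows "grad_within S f x = (\<chi> j. f' (axis j 1))"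
proof -
  have "(f has_derivative frechet_derivative f (at x within S)) (at x within S)"
    using assms(3) frechet_derivative_works differentiable_def by blast
  then have "frechet_derivative f (at x within S) = f'"
    using unique_derivatives_eq assms by blast
  then show ?thesis
    by (simp add: grad_within_def)
qed

lemma grad_within_diff:
  assumes "unique_derivatives S" "x \<in> S"
    and "f differentiable (at x within S)" "g differentiable (at x within S)"
  shows "grad_within S (\<lambda>t. f t - g t) x = grad_within S f x - grad_within S g x"
proof -
  obtain f' g' where f': "(f has_derivative f') (at x within S)"
    and g': "(g has_derivative g') (at x within S)"
    using assms(3,4) by (auto simp: differentiable_def)
  show ?thesis
    using grad_within_eq[OF assms(1,2) f'] grad_within_eq[OF assms(1,2) g']
      grad_within_eq[OF assms(1,2) has_derivative_diff[OF f' g']]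
    by (simp add: vec_eq_iff)
qed

section \<open>Lipschitz bounds for the Gaussian kernel and its gradient\<close>

lemma gaussian_has_derivative:
  "((\<lambda>z::'a::real_inner. exp (- (1 / \<kappa>) * (norm z)\<^sup>2)) has_derivative
    (\<lambda>h. - (2 / \<kappa>) * exp (- (1 / \<kappa>) * (norm z)\<^sup>2) * (z \<bullet> h))) (at z within S)"
  unfolding power2_norm_eq_inner
  \<comment> \<open>Division by zero gives 0, so for \<open>\<kappa> = 0\<close> the function is
    constantly 1 and the claimed derivative vanishes.\<close>
  by (cases "\<kappa> = 0") (auto intro!: derivative_eq_intros simp: inner_commute)

text \<open>Rescaling to \<open>t = (norm z)\<^sup>2 / \<kappa>\<close> turns the claim into
  \<open>t * exp (- t) \<le> 1\<close>, which follows from \<open>t \<le> exp t\<close>.\<close>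

lemma sq_mult_gaussian_le:
  fixes z :: "'a::real_inner"
  assumes "\<kappa> > 0"
  shows "(norm z)\<^sup>2 * exp (- (1 / \<kappa>) * (norm z)\<^sup>2) \<le> \<kappa>"
proof -
  define t where "t = (norm z)\<^sup>2 / \<kappa>"
  have "t \<le> exp t"
    using exp_ge_add_one_self[of t] by linarith
  then have "t * exp (- t) \<le> 1"
    by (simp add: exp_minus field_simps)
  then have "\<kappa> * (t * exp (- t)) \<le> \<kappa> * 1"
    using assms by (intro mult_left_mono) auto
  then show ?thesis
    using assms by (simp add: t_def)
qed

text \<open>Since \<open>norm z \<le> 1 + (norm z)\<^sup>2\<close>, the bound splits into the
  Gaussian itself, at most 1, and the previous estimate. The constant is not sharp, but it avoids
  locating the maximum.\<close>

lemma norm_mult_gaussian_le: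
  fixes z :: "'a::real_inner"
  assumes "\<kappa> > 0"
  shows "norm z * exp (- (1 / \<kappa>) * (norm z)\<^sup>2) \<le> 1 + \<kappa>"
proof -
  define E where "E = exp (- (1 / \<kappa>) * (norm z)\<^sup>2)"
  have E: "0 \<le> E" "E \<le> 1"
    using assms by (auto simp: E_def)
  have "0 \<le> (norm z - 1)\<^sup>2"
    by simp
  then have "norm z \<le> 1 + (norm z)\<^sup>2"
    unfolding power2_diff power_one mult_1_right using norm_ge_zero[of z] by linarith
  then have "norm z * E \<le> (1 + (norm z)\<^sup>2) * E"
    using E by (intro mult_right_mono)
  also have "\<dots> \<le> 1 + \<kappa>"
    using E sq_mult_gaussian_le[OF assms, of z, folded E_def] by (simp add: distrib_right)
  finally show ?thesis
    by (simp add: E_def)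
qed

text \<open>Mean value inequality: the derivative at \<open>w\<close> has operator norm at most
  \<open>2 / \<kappa>\<close> times \<open>norm w\<close> times the Gaussian, and the last two
  factors together are at most \<open>1 + \<kappa>\<close>.\<close>

lemma gaussian_lipschitz:
  fixes x z :: "'a::real_inner"
  assumes "\<kappa> > 0"
  shows "\<bar>exp (- (1 / \<kappa>) * (norm x)\<^sup>2) - exp (- (1 / \<kappa>) * (norm z)\<^sup>2)\<bar>
    \<le> (2 / \<kappa> + 2) * norm (x - z)"
proof -
  define \<phi> :: "'a \<Rightarrow> real" where "\<phi> w = exp (- (1 / \<kappa>) * (norm w)\<^sup>2)" for w
  have deriv: "(\<phi> has_derivative (\<lambda>h. - (2 / \<kappa>) * \<phi> w * (w \<bullet> h))) (at w)" for w
    unfolding \<phi>_def[abs_def] by (rule gaussian_has_derivative)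
  have "onorm (\<lambda>h. - (2 / \<kappa>) * \<phi> w * (w \<bullet> h)) \<le> 2 / \<kappa> + 2" for w
  proof (rule onorm_bound)
    fix h
    have "norm (- (2 / \<kappa>) * \<phi> w * (w \<bullet> h)) = (2 / \<kappa>) * \<phi> w * \<bar>w \<bullet> h\<bar>"
      using assms by (simp add: abs_mult \<phi>_def)
    also have "\<dots> \<le> (2 / \<kappa>) * \<phi> w * (norm w * norm h)"
      using assms by (intro mult_left_mono Cauchy_Schwarz_ineq2) (auto simp: \<phi>_def)
    also have "\<dots> = (2 / \<kappa>) * (norm w * \<phi> w) * norm h"
      by (simp add: algebra_simps)
    also have "\<dots> \<le> (2 / \<kappa>) * (1 + \<kappa>) * norm h"
      using norm_mult_gaussian_le[OF assms, of w] assms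
      by (intro mult_right_mono mult_left_mono) (auto simp: \<phi>_def)
    also have "\<dots> = (2 / \<kappa> + 2) * norm h"
      using assms by (simp add: field_simps)
    finally show "norm (- (2 / \<kappa>) * \<phi> w * (w \<bullet> h)) \<le> (2 / \<kappa> + 2) * norm h" .
  qed (use assms in simp)
  then have "norm (\<phi> x - \<phi> z) \<le> (2 / \<kappa> + 2) * norm (x - z)"
    using deriv
    by (intro differentiable_bound[of UNIV \<phi> "\<lambda>w h. - (2 / \<kappa>) * \<phi> w * (w \<bullet> h)"]) auto
  then show ?thesis
    by (simp add: \<phi>_def)
qed

text \<open>Up to a constant factor, this vector field is the gradient of the Gaussian. Its
  derivative \<open>D\<close> has two terms: the Gaussian times \<open>h\<close> contributes 1 to
  the Lipschitz constant, and the rank-one term contributes 2, because \<open>\<kappa>\<close>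
  cancels in \<open>sq_mult_gaussian_le\<close>.\<close>

lemma gaussian_scaleR_lipschitz:
  fixes x z :: "'a::real_inner"
  assumes "\<kappa> > 0"
  shows "norm (exp (- (1 / \<kappa>) * (norm x)\<^sup>2) *\<^sub>R x - exp (- (1 / \<kappa>) * (norm z)\<^sup>2) *\<^sub>R z)
    \<le> 3 * norm (x - z)"
proof -
  define \<phi> :: "'a \<Rightarrow> real" where "\<phi> w = exp (- (1 / \<kappa>) * (norm w)\<^sup>2)" for w
  define D where "D w h = \<phi> w *\<^sub>R h + (- (2 / \<kappa>) * \<phi> w * (w \<bullet> h)) *\<^sub>R w" for w h
  have deriv: "((\<lambda>w. \<phi> w *\<^sub>R w) has_derivative D w) (at w)" for w
    using has_derivative_scaleR[OF gaussian_has_derivative has_derivative_ident, of \<kappa> w UNIV]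
    by (simp add: \<phi>_def[abs_def] D_def[abs_def])
  have "onorm (D w) \<le> 3" for w
  proof (rule onorm_bound)
    fix h
    have \<phi>: "0 \<le> \<phi> w" "\<phi> w \<le> 1"
      using assms by (auto simp: \<phi>_def)
    have "norm ((- (2 / \<kappa>) * \<phi> w * (w \<bullet> h)) *\<^sub>R w) = (2 / \<kappa>) * \<phi> w * norm w * \<bar>w \<bullet> h\<bar>"
      using assms by (simp add: abs_mult \<phi>_def)
    also have "\<dots> \<le> (2 / \<kappa>) * \<phi> w * norm w * (norm w * norm h)"
      using assms \<phi> by (intro mult_left_mono Cauchy_Schwarz_ineq2) auto
    also have "\<dots> = (2 / \<kappa>) * ((norm w)\<^sup>2 * \<phi> w) * norm h"
      by (simp add: algebra_simps power2_eq_square)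
    also have "\<dots> \<le> (2 / \<kappa>) * \<kappa> * norm h"
      using sq_mult_gaussian_le[OF assms, of w] assms
      by (intro mult_right_mono mult_left_mono) (auto simp: \<phi>_def)
    also have "\<dots> = 2 * norm h"
      using assms by simp
    finally have "norm ((- (2 / \<kappa>) * \<phi> w * (w \<bullet> h)) *\<^sub>R w) \<le> 2 * norm h" .
    moreover have "norm (\<phi> w *\<^sub>R h) \<le> norm h"
      using \<phi> by (simp add: mult_left_le_one_le)
    ultimately show "norm (D w h) \<le> 3 * norm h"
      unfolding D_def by (intro norm_triangle_le) linarith
  qed simp
  then show ?thesis
    using differentiable_bound[of UNIV "\<lambda>w. \<phi> w *\<^sub>R w" D 3 x z] deriv
    by (auto simp: \<phi>_def)
qed

lemma gauss_kernel_lipschitz: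
  assumes "\<kappa> > 0"
  shows "\<bar>gauss_kernel \<kappa> x x' - gauss_kernel \<kappa> z z'\<bar>
    \<le> (2 / \<kappa> + 2) * (norm1 (x - z) + norm1 (x' - z'))"
proof -
  have "\<bar>gauss_kernel \<kappa> x x' - gauss_kernel \<kappa> z z'\<bar>
      \<le> (2 / \<kappa> + 2) * norm ((x - x') - (z - z'))"
    unfolding gauss_kernel_def by (rule gaussian_lipschitz[OF assms])
  also have "norm ((x - x') - (z - z')) \<le> norm1 (x - z) + norm1 (x' - z')"
    using norm_le_norm1[of "(x - x') - (z - z')"] norm1_diff_le[of "x - z" "x' - z'"]
    by (simp add: algebra_simps)
  finally show ?thesis
    using assms by (simp add: mult_left_mono)
qed

lemma gauss_kernel_bounds:
  assumes "\<kappa> > 0"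
  shows "0 \<le> gauss_kernel \<kappa> x x'" "gauss_kernel \<kappa> x x' \<le> 1"
  using assms by (auto simp: gauss_kernel_def)

lemma grad_gauss_kernel:
  "grad_within UNIV (\<lambda>x. gauss_kernel \<kappa> x x') x
    = (- (2 / \<kappa>)) *\<^sub>R (gauss_kernel \<kappa> x x' *\<^sub>R (x - x'))"
proof -
  have diff: "((\<lambda>x. x - x') has_derivative (\<lambda>h. h)) (at x)"
    by (auto intro!: derivative_eq_intros)
  have "((\<lambda>x. gauss_kernel \<kappa> x x') has_derivative
      (\<lambda>h. - (2 / \<kappa>) * gauss_kernel \<kappa> x x' * ((x - x') \<bullet> h))) (at x)"
    unfolding gauss_kernel_def
    by (rule has_derivative_compose[OF diff gaussian_has_derivative])
  from grad_within_eq[OF unique_derivatives_open[OF open_UNIV] UNIV_I this]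
  show ?thesis
    by (simp add: vec_eq_iff inner_axis)
qed

text \<open>The constant is the product of \<open>2 / \<kappa>\<close> from the gradient formula, 3
  from \<open>gaussian_scaleR_lipschitz\<close>, and the dimension, which is the price of passing
  from the Euclidean norm to the l1-norm.\<close>

lemma grad_gauss_kernel_lipschitz:
  fixes x x' z z' :: "real^'d"
  assumes "\<kappa> > 0"
  shows "norm1 (grad_within UNIV (\<lambda>x. gauss_kernel \<kappa> x x') x
      - grad_within UNIV (\<lambda>x. gauss_kernel \<kappa> x z') z)
    \<le> 6 * real CARD('d) / \<kappa> * (norm1 (x - z) + norm1 (x' - z'))"
proof -
  define g where "g = gauss_kernel \<kappa> x x' *\<^sub>R (x - x') - gauss_kernel \<kappa> z z' *\<^sub>R (z - z')"
  have "norm g \<le> 3 * norm ((x - x') - (z - z'))"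
    unfolding g_def gauss_kernel_def by (rule gaussian_scaleR_lipschitz[OF assms])
  also have "norm ((x - x') - (z - z')) \<le> norm1 (x - z) + norm1 (x' - z')"
    using norm_le_norm1[of "(x - x') - (z - z')"] norm1_diff_le[of "x - z" "x' - z'"]
    by (simp add: algebra_simps)
  finally have g: "norm g \<le> 3 * (norm1 (x - z) + norm1 (x' - z'))"
    by simp
  have "norm1 (grad_within UNIV (\<lambda>x. gauss_kernel \<kappa> x x') x
      - grad_within UNIV (\<lambda>x. gauss_kernel \<kappa> x z') z) = norm1 ((- (2 / \<kappa>)) *\<^sub>R g)"
    by (simp only: grad_gauss_kernel g_def scaleR_diff_right)
  also have "\<dots> = 2 / \<kappa> * norm1 g"
    using assms by (simp only: norm1_scaleR) simp
  also have "\<dots> \<le> 2 / \<kappa> * (real CARD('d) * (3 * (norm1 (x - z) + norm1 (x' - z'))))"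
    using assms g norm1_le_card_norm[of g]
    by (intro mult_left_mono) (auto intro: order_trans mult_left_mono)
  finally show ?thesis
    by (simp add: algebra_simps add_divide_distrib)
qed

section \<open>Propagation of a score perturbation through the descent iteration\<close>

text \<open>The update of one sample involves all the others, so the deviation must be controlled by
  a common bound \<open>B\<close> over all samples. The three terms in the amplification rate come
  from the change of the kernel, of the exact score and of the kernel gradient; the score error
  enters additively.\<close>

lemma svgd_samples_step_diff:
  fixes x z x' z' :: "nat \<Rightarrow> real^'d"
  assumes \<kappa>: "\<kappa> > 0" and M: "M \<ge> 1" and \<alpha>: "\<alpha> \<ge> 0" and L: "L \<ge> 0"
    and lip: "\<And>t t'. t \<in> \<Theta> \<Longrightarrow> t' \<in> \<Theta> \<Longrightarrow> norm1 (s t - s t') \<le> L * norm1 (t - t')"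
    and \<Theta>: "\<And>m. m \<in> {1..M} \<Longrightarrow> x m \<in> \<Theta>" "\<And>m. m \<in> {1..M} \<Longrightarrow> z m \<in> \<Theta>"
    and S: "\<And>m. m \<in> {1..M} \<Longrightarrow> norm1 (s (x m)) \<le> S"
    and B: "\<And>m. m \<in> {1..M} \<Longrightarrow> norm1 (x m - z m) \<le> B"
    and n: "n \<in> {1..M}"
    and x': "x' n = x n + \<alpha> *\<^sub>R ((1 / real M) *\<^sub>R
        (\<Sum>m=1..M. gauss_kernel \<kappa> (x m) (x n) *\<^sub>R s (x m) +
                    grad_within UNIV (\<lambda>t. gauss_kernel \<kappa> t (x n)) (x m)))"
    and z': "z' n = z n + \<alpha> *\<^sub>R ((1 / real M) *\<^sub>R
        (\<Sum>m=1..M. gauss_kernel \<kappa> (z m) (z n) *\<^sub>R s' (z m) +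
                    grad_within UNIV (\<lambda>t. gauss_kernel \<kappa> t (z n)) (z m)))"
  shows "norm1 (x' n - z' n)
    \<le> (1 + \<alpha> * ((2 / \<kappa> + 2) * 2 * S + L + 12 * real CARD('d) / \<kappa>)) * B
      + \<alpha> * ((1 / real M) * (\<Sum>m=1..M. norm1 (s (z m) - s' (z m))))"
proof -
  define Q where "Q = (2 / \<kappa> + 2) * 2 * S + L + 12 * real CARD('d) / \<kappa>"
  define e where "e m = norm1 (s (z m) - s' (z m))" for m
  define kx where "kx m = gauss_kernel \<kappa> (x m) (x n)" for m
  define kz where "kz m = gauss_kernel \<kappa> (z m) (z n)" for m
  define gx where "gx m = grad_within UNIV (\<lambda>t. gauss_kernel \<kappa> t (x n)) (x m)" for m
  define gz where "gz m = grad_within UNIV (\<lambda>t. gauss_kernel \<kappa> t (z n)) (z m)" for m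
  have term_le: "norm1 ((kx m *\<^sub>R s (x m) + gx m) - (kz m *\<^sub>R s' (z m) + gz m)) \<le> Q * B + e m"
    if m: "m \<in> {1..M}" for m
  proof -
    have kz: "0 \<le> kz m" "kz m \<le> 1"
      using gauss_kernel_bounds[OF \<kappa>] by (auto simp: kz_def)
    have B2: "norm1 (x m - z m) + norm1 (x n - z n) \<le> 2 * B"
      using B[OF m] B[OF n] by simp
    have "\<bar>kx m - kz m\<bar> \<le> (2 / \<kappa> + 2) * (norm1 (x m - z m) + norm1 (x n - z n))"
      unfolding kx_def kz_def by (rule gauss_kernel_lipschitz[OF \<kappa>])
    also have "\<dots> \<le> (2 / \<kappa> + 2) * (2 * B)"
      using B2 \<kappa> by (intro mult_left_mono) auto
    finally have "\<bar>kx m - kz m\<bar> * norm1 (s (x m)) \<le> (2 / \<kappa> + 2) * (2 * B) * S"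
      using S[OF m] \<kappa> order_trans[OF norm1_nonneg B[OF m]] by (intro mult_mono) (auto simp: norm1_nonneg)
    then have 1: "norm1 ((kx m - kz m) *\<^sub>R s (x m)) \<le> (2 / \<kappa> + 2) * (2 * B) * S"
      by (simp only: norm1_scaleR)
    have "norm1 (s (x m) - s (z m)) \<le> L * norm1 (x m - z m)"
      using lip \<Theta> m by blast
    also have "\<dots> \<le> L * B"
      using B[OF m] L by (intro mult_left_mono)
    finally have "kz m * norm1 (s (x m) - s (z m)) \<le> 1 * (L * B)"
      using kz by (intro mult_mono) (auto simp: norm1_nonneg)
    then have 2: "norm1 (kz m *\<^sub>R (s (x m) - s (z m))) \<le> L * B"
      using kz by (simp add: norm1_scaleR)
    have "kz m * e m \<le> 1 * e m"
      using kz by (intro mult_right_mono) (auto simp: e_def norm1_nonneg)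
    then have 3: "norm1 (kz m *\<^sub>R (s (z m) - s' (z m))) \<le> e m"
      using kz by (simp add: norm1_scaleR e_def)
    have "norm1 (gx m - gz m) \<le> 6 * real CARD('d) / \<kappa> * (norm1 (x m - z m) + norm1 (x n - z n))"
      unfolding gx_def gz_def by (rule grad_gauss_kernel_lipschitz[OF \<kappa>])
    also have "\<dots> \<le> 6 * real CARD('d) / \<kappa> * (2 * B)"
      using B2 \<kappa> by (intro mult_left_mono) auto
    finally have 4: "norm1 (gx m - gz m) \<le> 6 * real CARD('d) / \<kappa> * (2 * B)" .
    \<comment> \<open>The intermediate terms are chosen so that the kernel difference meets only the
      exact score at an exact sample, bounded by \<open>S\<close>, the Lipschitz condition is
      applied to \<open>s\<close> alone, and the error \<open>s - s'\<close> is evaluated at the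
      perturbed sample \<open>z m\<close>.\<close>
    have decomposition: "(kx m *\<^sub>R s (x m) + gx m) - (kz m *\<^sub>R s' (z m) + gz m)
        = (kx m - kz m) *\<^sub>R s (x m) + kz m *\<^sub>R (s (x m) - s (z m))
          + kz m *\<^sub>R (s (z m) - s' (z m)) + (gx m - gz m)"
      by (simp add: algebra_simps)
    have "norm1 ((kx m *\<^sub>R s (x m) + gx m) - (kz m *\<^sub>R s' (z m) + gz m))
        \<le> norm1 ((kx m - kz m) *\<^sub>R s (x m)) + norm1 (kz m *\<^sub>R (s (x m) - s (z m)))
          + norm1 (kz m *\<^sub>R (s (z m) - s' (z m))) + norm1 (gx m - gz m)"
      unfolding decomposition by (rule norm1_add4_le)
    also have "\<dots> \<le> Q * B + e m"
      using 1 2 3 4 by (simp add: Q_def algebra_simps)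
    finally show ?thesis .
  qed
  define d where "d m = (kx m *\<^sub>R s (x m) + gx m) - (kz m *\<^sub>R s' (z m) + gz m)" for m
  have "x' n - z' n = (x n - z n) + (\<alpha> * (1 / real M)) *\<^sub>R (\<Sum>m=1..M. d m)"
    unfolding x' z' d_def kx_def kz_def gx_def gz_def sum_subtractf
    by (simp add: algebra_simps)
  then have "norm1 (x' n - z' n) \<le> norm1 (x n - z n) + (\<alpha> * (1 / real M)) * norm1 (\<Sum>m=1..M. d m)"
    using norm1_add_le[of "x n - z n" "(\<alpha> * (1 / real M)) *\<^sub>R (\<Sum>m=1..M. d m)"] \<alpha>
    by (simp add: norm1_scaleR)
  also have "\<dots> \<le> B + (\<alpha> * (1 / real M)) * (\<Sum>m=1..M. Q * B + e m)"
    using B[OF n] \<alpha> term_le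
    by (intro add_mono mult_left_mono order_trans[OF norm1_sum_le] sum_mono) (auto simp: d_def)
  \<comment> \<open>Averaging the constant \<open>Q * B\<close> over the \<open>M\<close> samples
    gives it back, as \<open>M\<close> is nonzero.\<close>
  also have "\<dots> = (1 + \<alpha> * Q) * B + \<alpha> * ((1 / real M) * (\<Sum>m=1..M. e m))"
    using M by (simp add: sum.distrib field_simps)
  finally show ?thesis
    by (simp add: Q_def e_def)
qed

text \<open>The constants \<open>C\<close> depend on the exact samples \<open>x\<close> (through their scores) but not on the
  perturbed score \<open>s'\<close> and its samples \<open>z\<close>.\<close>

lemma svgd_samples_perturbation:
  fixes x :: "nat \<Rightarrow> nat \<Rightarrow> real^'d"
  assumes \<kappa>: "\<kappa> > 0" and M: "M \<ge> 1" and \<alpha>: "\<And>i. \<alpha> i > 0" and L: "L \<ge> 0"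
    and lip: "\<And>t t'. t \<in> \<Theta> \<Longrightarrow> t' \<in> \<Theta> \<Longrightarrow> norm1 (s t - s t') \<le> L * norm1 (t - t')"
    and x: "svgd_samples \<kappa> M \<alpha> s x"
    and x\<Theta>: "\<And>i m. m \<in> {1..M} \<Longrightarrow> x i m \<in> \<Theta>"
  shows "\<exists>C. \<forall>s' \<beta> z. (\<forall>i<k. \<alpha> i = \<beta> i) \<longrightarrow> svgd_samples \<kappa> M \<beta> s' z \<longrightarrow>
    (\<forall>n\<in>{1..M}. z 0 n = x 0 n) \<longrightarrow> (\<forall>i. \<forall>n\<in>{1..M}. z i n \<in> \<Theta>) \<longrightarrow>
    (\<forall>n\<in>{1..M}. norm1 (x k n - z k n)
      \<le> (\<Sum>i<k. C i * ((1 / real M) * (\<Sum>m=1..M. norm1 (s (z i m) - s' (z i m))))))"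
proof (induction k)
  case 0
  show ?case
    by (simp add: norm1_def)
next
  case (Suc k)
  then obtain C where C: "\<And>s' \<beta> z n. \<lbrakk>\<forall>i<k. \<alpha> i = \<beta> i; svgd_samples \<kappa> M \<beta> s' z;
      \<forall>n\<in>{1..M}. z 0 n = x 0 n; \<forall>i. \<forall>n\<in>{1..M}. z i n \<in> \<Theta>; n \<in> {1..M}\<rbrakk> \<Longrightarrow>
      norm1 (x k n - z k n)
      \<le> (\<Sum>i<k. C i * ((1 / real M) * (\<Sum>m=1..M. norm1 (s (z i m) - s' (z i m)))))"
    by blast
  \<comment> \<open>The sum serves as an upper bound for the largest score at step \<open>k\<close>.
    It involves the exact samples only, so it may enter the constants fixed before
    \<open>s'\<close>, \<open>\<beta>\<close> and \<open>z\<close>.\<close>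
  define S where "S = (\<Sum>m=1..M. norm1 (s (x k m)))"
  have S: "norm1 (s (x k m)) \<le> S" if "m \<in> {1..M}" for m
    unfolding S_def using that by (intro member_le_sum) (auto simp: norm1_nonneg)
  \<comment> \<open>The amplification factor of step \<open>k\<close>, as delivered by
    \<open>svgd_samples_step_diff\<close>.\<close>
  define a where "a = 1 + \<alpha> k * ((2 / \<kappa> + 2) * 2 * S + L + 12 * real CARD('d) / \<kappa>)"
  show ?case
  proof (intro exI allI impI ballI)
    fix s' \<beta> z n
    assume \<beta>: "\<forall>i<Suc k. \<alpha> i = \<beta> i" and z: "svgd_samples \<kappa> M \<beta> s' z"
      and z0: "\<forall>n\<in>{1..M}. z 0 n = x 0 n" and z\<Theta>: "\<forall>i. \<forall>n\<in>{1..M}. z i n \<in> \<Theta>"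
      and n: "n \<in> {1..M}"
    define E where "E i = (1 / real M) * (\<Sum>m=1..M. norm1 (s (z i m) - s' (z i m)))" for i
    define B where "B = (\<Sum>i<k. C i * E i)"
    have B: "norm1 (x k m - z k m) \<le> B" if "m \<in> {1..M}" for m
      unfolding B_def E_def using \<beta> by (intro C[OF _ z z0 z\<Theta> that]) auto
    have "norm1 (x (Suc k) n - z (Suc k) n) \<le> a * B + \<alpha> k * E k"
      unfolding a_def E_def
    proof (rule svgd_samples_step_diff[OF \<kappa> M less_imp_le[OF \<alpha>] L lip x\<Theta> _ S B n])
      show "x (Suc k) n = x k n + \<alpha> k *\<^sub>R ((1 / real M) *\<^sub>R
        (\<Sum>m=1..M. gauss_kernel \<kappa> (x k m) (x k n) *\<^sub>R s (x k m) +
                    grad_within UNIV (\<lambda>t. gauss_kernel \<kappa> t (x k n)) (x k m)))"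
        using x n unfolding svgd_samples_def by blast
      show "z (Suc k) n = z k n + \<alpha> k *\<^sub>R ((1 / real M) *\<^sub>R
        (\<Sum>m=1..M. gauss_kernel \<kappa> (z k m) (z k n) *\<^sub>R s' (z k m) +
                    grad_within UNIV (\<lambda>t. gauss_kernel \<kappa> t (z k n)) (z k m)))"
        using z n \<beta> unfolding svgd_samples_def by simp
    qed (use z\<Theta> in auto)
    \<comment> \<open>This supplies the witness for the new constants: errors committed before step
      \<open>k\<close> are amplified by \<open>a\<close>, and the error of step \<open>k\<close>
      itself enters with its step size.\<close>
    also have "\<dots> = (\<Sum>i<Suc k. (if i = k then \<alpha> k else a * C i) * E i)"
      by (simp add: B_def sum_distrib_left mult.assoc)
    finally show "norm1 (x (Suc k) n - z (Suc k) n) \<le> (\<Sum>i<Suc k.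
        (if i = k then \<alpha> k else a * C i) *
          ((1 / real M) * (\<Sum>m=1..M. norm1 (s (z i m) - s' (z i m)))))"
      by (simp only: E_def)
  qed
qed

section \<open>Solvability of the Galerkin equation and differentiability of its solution\<close>

text \<open>Lax-Milgram on a finite-dimensional space for a form that may be nonsymmetric. Induction
  on the spanning set, in the manner of Gram-Schmidt: a solution on \<open>span B\<close> is
  corrected by a vector that is orthogonal to \<open>span B\<close> with respect to the
  form.\<close>

lemma coercive_form_represents:
  fixes a :: "'v::real_inner \<Rightarrow>\<^sub>L 'v \<Rightarrow>\<^sub>L real"
  assumes coercive: "\<And>w. c * (norm w)\<^sup>2 \<le> a w w" and c: "c > 0"
    and g: "linear g" and B: "finite B"
  shows "\<exists>w\<in>span B. \<forall>v\<in>span B. a w v = g v"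
proof -
  have lin: "linear (blinfun_apply (a w))" for w
    using bounded_linear.linear blinfun.bounded_linear_right by blast
  \<comment> \<open>The functional is generalised because the induction hypothesis is needed twice:
    for the given functional and for \<open>a b\<close>.\<close>
  have *: "\<exists>w\<in>span B. \<forall>v\<in>B. a w v = g v" if "linear g" for g :: "'v \<Rightarrow> real"
    using B that
  proof (induction B arbitrary: g rule: finite_induct)
    case empty
    show ?case by auto
  next
    case (insert b B)
    obtain w1 where w1: "w1 \<in> span B" "\<forall>v\<in>B. a w1 v = g v"
      using insert by blast
    obtain w2 where w2: "w2 \<in> span B" "\<forall>v\<in>B. a w2 v = a b v"
      using insert.IH[OF lin[of b]] by blast
    have w1_span: "a w1 v = g v" if "v \<in> span B" for v
      using linear_eq_on_span[OF lin insert.prems] w1(2) that by blast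
    \<comment> \<open>The vector \<open>b\<close> with its component in \<open>span B\<close>
      removed: \<open>w2\<close> reproduces \<open>a b\<close> on \<open>B\<close>, so
      \<open>a z\<close> vanishes on \<open>span B\<close>.\<close>
    define z where "z = b - w2"
    have z_orth: "a z v = 0" if "v \<in> span B" for v
    proof -
      have "a w2 v = a b v"
        by (rule linear_eq_on_span[OF lin lin _ that]) (use w2(2) in auto)
      then show ?thesis
        by (simp add: z_def blinfun.bilinear_simps)
    qed
    have span: "w1 + t *\<^sub>R z \<in> span (insert b B)" for t
      unfolding z_def using w1(1) w2(1)
      by (intro span_add span_scale span_diff) (auto intro: span_base span_mono[THEN subsetD, of B])
    show ?case
    proof (cases "z = 0")
      case True
      then have "a w1 b = g b"
        using w1_span w2(1) by (simp add: z_def)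
      then show ?thesis
        using w1 span[of 0] by auto
    next
      case False
      have "a z b = a z z"
        using z_orth[OF w2(1)] by (simp add: z_def blinfun.bilinear_simps)
      moreover have "a z z > 0"
      proof -
        have "0 < c * (norm z)\<^sup>2"
          using False c by simp
        then show ?thesis
          using coercive[of z] by linarith
      qed
      \<comment> \<open>Because \<open>a z b = a z z > 0\<close>, the value at \<open>b\<close> can
        be corrected by a multiple of \<open>z\<close>; this leaves the values on \<open>B\<close>
        unchanged.\<close>
      ultimately have "a (w1 + ((g b - a w1 b) / a z z) *\<^sub>R z) b = g b"
        by (simp add: blinfun.bilinear_simps)
      moreover have "a (w1 + t *\<^sub>R z) v = g v" if "v \<in> B" for t v
        using w1(2) that z_orth[OF span_base[OF that]]
        by (simp add: blinfun.bilinear_simps)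
      ultimately show ?thesis
        using span by blast
    qed
  qed
  obtain w where "w \<in> span B" "\<forall>v\<in>B. a w v = g v"
    using *[OF g] by blast
  then show ?thesis
    using linear_eq_on_span[OF lin g] by blast
qed

text \<open>The a priori estimate behind all bounds below: test the equation with the solution
  itself and cancel one factor \<open>norm w\<close>.\<close>

lemma coercive_norm_le:
  fixes a :: "'v::real_inner \<Rightarrow>\<^sub>L 'v \<Rightarrow>\<^sub>L real"
  assumes "c * (norm w)\<^sup>2 \<le> a w w" "a w w \<le> r * norm w" "c > 0" "r \<ge> 0"
  shows "c * norm w \<le> r"
proof (cases "w = 0")
  case False
  have "(c * norm w) * norm w \<le> r * norm w"
    using assms(1,2) by (simp add: power2_eq_square mult.assoc)
  then show ?thesis
    using False by simp
qed (use assms in simp)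

lemma blinfun_apply2_le: "(a :: 'v::real_normed_vector \<Rightarrow>\<^sub>L 'v \<Rightarrow>\<^sub>L real) w v \<le> norm a * norm w * norm v"
proof -
  have "a w v \<le> norm (a w) * norm v"
    using norm_blinfun[of "a w" v] by simp
  also have "\<dots> \<le> norm a * norm w * norm v"
    by (intro mult_right_mono norm_blinfun) auto
  finally show ?thesis .
qed

lemma blinfun_apply_real_le: "(f :: 'v::real_normed_vector \<Rightarrow>\<^sub>L real) v \<le> norm f * norm v"
  using norm_blinfun[of f v] by simp

text \<open>Two rounds of the same energy estimate. The first shows that \<open>u\<close> is
  continuous at \<open>x\<close>; the second compares the increment of \<open>u\<close> with the
  solution \<open>D\<close> of the linearised equation. Continuity is needed first, because the
  defect contains the product of the increments of \<open>a\<close> and \<open>u\<close>.\<close>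

lemma galerkin_differentiable:
  fixes a :: "'p::euclidean_space \<Rightarrow> 'v::real_inner \<Rightarrow>\<^sub>L 'v \<Rightarrow>\<^sub>L real"
    and f :: "'p \<Rightarrow> 'v \<Rightarrow>\<^sub>L real"
  assumes W: "subspace W" "W \<subseteq> span B" "finite B"
    and coercive: "\<And>w. c * (norm w)\<^sup>2 \<le> a x w w" and c: "c > 0"
    and x: "x \<in> S"
    and a: "(a has_derivative a') (at x within S)"
    and f: "(f has_derivative f') (at x within S)"
    and uW: "\<And>t. t \<in> S \<Longrightarrow> u t \<in> W"
    and u: "\<And>t v. t \<in> S \<Longrightarrow> v \<in> W \<Longrightarrow> a t (u t) v = f t v"
  shows "u differentiable (at x within S)"
proof -
  have a'_lin: "bounded_linear a'" and f'_lin: "bounded_linear f'"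
    using a f has_derivative_bounded_linear by auto
  have a_cont: "(a \<longlongrightarrow> a x) (at x within S)" and f_cont: "(f \<longlongrightarrow> f x) (at x within S)"
    using has_derivative_continuous[OF a] has_derivative_continuous[OF f]
    by (auto simp: continuous_within)
  define \<delta> where "\<delta> t = u t - u x" for t
  have \<delta>W: "\<delta> t \<in> W" if "t \<in> S" for t
    unfolding \<delta>_def using uW x that W(1) by (intro subspace_diff)

  \<comment> \<open>Subtraction of the equations at \<open>t\<close> and \<open>x\<close>, arranged
    so that the form on the left is frozen at \<open>x\<close>, where coercivity is
    available.\<close>
  have \<delta>_eq: "a x (\<delta> t) v = (f t - f x) v - (a t - a x) (u t) v" if "t \<in> S" "v \<in> W" for t v
    using u[OF that] u[OF x that(2)] by (simp add: \<delta>_def blinfun.diff_left blinfun.diff_right)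
  have \<delta>_le: "c * norm (\<delta> t) \<le> norm (f t - f x) + norm (a t - a x) * norm (u t)"
    if "t \<in> S" for t
  proof (rule coercive_norm_le[OF coercive])
    have "a x (\<delta> t) (\<delta> t) = (f t - f x) (\<delta> t) + (a x - a t) (u t) (\<delta> t)"
      using \<delta>_eq[OF that \<delta>W[OF that]] by (simp add: blinfun.diff_left)
    also have "\<dots> \<le> norm (f t - f x) * norm (\<delta> t) + norm (a x - a t) * norm (u t) * norm (\<delta> t)"
      by (intro add_mono blinfun_apply2_le blinfun_apply_real_le)
    finally show "a x (\<delta> t) (\<delta> t) \<le> (norm (f t - f x) + norm (a t - a x) * norm (u t)) * norm (\<delta> t)"
      by (simp add: norm_minus_commute algebra_simps)
  qed (use c in auto)
  \<comment> \<open>The threshold \<open>c / 2\<close> lets half of the coercive term absorb the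
    contribution of \<open>norm (\<delta> t)\<close> that is hidden in
    \<open>norm (u t)\<close>.\<close>
  have "eventually (\<lambda>t. dist (a t) (a x) < c / 2) (at x within S)"
    using tendstoD[OF a_cont, of "c / 2"] c by simp
  then have "eventually (\<lambda>t. norm (\<delta> t)
      \<le> 2 / c * (norm (f t - f x) + norm (a t - a x) * norm (u x))) (at x within S)"
    unfolding eventually_at_filter
  proof (eventually_elim, safe)
    fix t assume t: "dist (a t) (a x) < c / 2" "t \<in> S"
    have "norm (a t - a x) * norm (u t) \<le> norm (a t - a x) * (norm (u x) + norm (\<delta> t))"
      unfolding \<delta>_def by (intro mult_left_mono norm_triangle_sub) auto
    also have "norm (a t - a x) * norm (\<delta> t) \<le> c / 2 * norm (\<delta> t)"
      using t by (intro mult_right_mono) (auto simp: dist_norm)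
    then have "norm (a t - a x) * (norm (u x) + norm (\<delta> t))
        \<le> norm (a t - a x) * norm (u x) + c / 2 * norm (\<delta> t)"
      by (simp add: distrib_left)
    finally have "c / 2 * norm (\<delta> t) \<le> norm (f t - f x) + norm (a t - a x) * norm (u x)"
      using \<delta>_le[OF t(2)] by (simp add: algebra_simps)
    then show "norm (\<delta> t) \<le> 2 / c * (norm (f t - f x) + norm (a t - a x) * norm (u x))"
      using c by (simp add: field_simps)
  qed
  moreover have "((\<lambda>t. 2 / c * (norm (f t - f x) + norm (a t - a x) * norm (u x)))
      \<longlongrightarrow> 2 / c * (norm (f x - f x) + norm (a x - a x) * norm (u x))) (at x within S)"
    by (intro tendsto_intros a_cont f_cont)
  ultimately have \<delta>_cont: "(\<delta> \<longlongrightarrow> 0) (at x within S)"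
    by (intro Lim_null_comparison[of \<delta>]) auto

  \<comment> \<open>The given \<open>B\<close> spans a space that may exceed \<open>W\<close>,
    whereas \<open>coercive_form_represents\<close> solves on the whole span; hence a basis of
    \<open>W\<close> itself.\<close>
  obtain B' where B': "B' \<subseteq> W" "independent B'" "W \<subseteq> span B'"
    by (rule basis_exists[of W])
  then have "finite B'"
    using independent_span_bound[OF W(3) B'(2)] W(2) by auto
  moreover have "span B' = W"
    using B'(3) span_minimal[OF B'(1) W(1)] by (intro subset_antisym)
  ultimately have "\<exists>w\<in>W. \<forall>v\<in>W. a x w v = (f' h - a' h (u x)) v" for h
    using coercive_form_represents[OF coercive c
        bounded_linear.linear[OF blinfun.bounded_linear_right]]
    by metis
  \<comment> \<open>The candidate derivative: differentiating \<open>a t (u t) v = f t v\<close> at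
    \<open>x\<close> in direction \<open>h\<close> gives exactly this equation for
    \<open>D h\<close>.\<close>
  then obtain D where DW: "\<And>h. D h \<in> W"
    and D: "\<And>h v. v \<in> W \<Longrightarrow> a x (D h) v = (f' h - a' h (u x)) v"
    by metis
  \<comment> \<open>\<open>D\<close> is obtained by a pointwise choice; uniqueness of the solution
    in \<open>W\<close> makes it linear.\<close>
  have unique: "w = w'" if "w \<in> W" "w' \<in> W" "\<And>v. v \<in> W \<Longrightarrow> a x w v = a x w' v" for w w'
  proof -
    have "a x (w - w') (w - w') = 0"
      using that subspace_diff[OF W(1) that(1,2)] by (simp add: blinfun.bilinear_simps)
    then have "c * norm (w - w') \<le> 0"
      by (intro coercive_norm_le[OF coercive]) (use c in auto)
    then show ?thesis
      using c by (simp add: mult_le_0_iff)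
  qed
  interpret a': bounded_linear a' by (rule a'_lin)
  interpret f': bounded_linear f' by (rule f'_lin)
  have "linear D"
  proof (rule linearI)
    show "D (h + k) = D h + D k" for h k
    proof (rule unique[OF DW subspace_add[OF W(1) DW DW]])
      fix v assume "v \<in> W"
      then show "a x (D (h + k)) v = a x (D h + D k) v"
        by (simp add: D blinfun.bilinear_simps a'.add f'.add)
    qed
    show "D (r *\<^sub>R h) = r *\<^sub>R D h" for r h
    proof (rule unique[OF DW subspace_scale[OF W(1) DW]])
      fix v assume "v \<in> W"
      then show "a x (D (r *\<^sub>R h)) v = a x (r *\<^sub>R D h) v"
        by (simp add: D blinfun.bilinear_simps a'.scaleR f'.scaleR right_diff_distrib)
    qed
  qed
  \<comment> \<open>The parameter space is Euclidean, so linearity already implies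
    boundedness.\<close>
  then have D_lin: "bounded_linear D"
    by (simp add: linear_conv_bounded_linear)

  obtain K where K: "\<And>h. norm (a' h) \<le> norm h * K"
    using bounded_linear.bounded[OF a'_lin] by blast
  define Ra where "Ra t = norm (a t - a x - a' (t - x)) / norm (t - x)" for t
  define Rf where "Rf t = norm (f t - f x - f' (t - x)) / norm (t - x)" for t
  define H where "H t = (Rf t + Ra t * norm (u x) + (Ra t + K) * norm (\<delta> t)) / c" for t
  have "(u has_derivative D) (at x within S)"
  proof (rule has_derivativeI_sandwich[OF zero_less_one D_lin, of S x u H])
    fix t assume t: "t \<in> S" "t \<noteq> x" "dist t x < 1"
    define \<rho> where "\<rho> = \<delta> t - D (t - x)"
    define h where "h = t - x"
    have h: "norm h > 0"
      using t by (simp add: h_def)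
    have \<rho>W: "\<rho> \<in> W"
      unfolding \<rho>_def using \<delta>W[OF t(1)] DW W(1) by (intro subspace_diff)
    \<comment> \<open>Inserting \<open>u t = u x + \<delta> t\<close> into
      \<open>\<delta>_eq\<close> and subtracting the equation for \<open>D h\<close> leaves the
      Taylor remainders of \<open>f\<close> and \<open>a\<close> and one product of
      increments.\<close>
    have "a x \<rho> \<rho> = (f t - f x - f' h) \<rho> + (a x - a t + a' h) (u x) \<rho> + (a x - a t) (\<delta> t) \<rho>"
      using \<delta>_eq[OF t(1) \<rho>W] D[OF \<rho>W, of h]
      by (simp add: \<rho>_def h_def \<delta>_def blinfun.diff_left blinfun.add_left blinfun.diff_right)
    also have "\<dots> \<le> norm (f t - f x - f' h) * norm \<rho> + norm (a x - a t + a' h) * norm (u x) * norm \<rho>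
        + norm (a x - a t) * norm (\<delta> t) * norm \<rho>"
      by (intro add_mono blinfun_apply2_le blinfun_apply_real_le)
    also have "\<dots> = (norm (f t - f x - f' h) + norm (a t - a x - a' h) * norm (u x)
        + norm (a t - a x) * norm (\<delta> t)) * norm \<rho>"
      using norm_minus_cancel[of "a t - a x - a' h"]
      by (simp add: norm_minus_commute[of "a x"] algebra_simps)
    finally have "c * norm \<rho> \<le> norm (f t - f x - f' h) + norm (a t - a x - a' h) * norm (u x)
        + norm (a t - a x) * norm (\<delta> t)"
      using c by (intro coercive_norm_le[OF coercive]) auto
    also have "\<dots> \<le> norm (f t - f x - f' h) + norm (a t - a x - a' h) * norm (u x)
        + (norm (a t - a x - a' h) + norm h * K) * norm (\<delta> t)"
      using norm_triangle_sub[of "a t - a x" "a' h"] K[of h]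
      by (intro add_mono mult_right_mono) auto
    also have "\<dots> = c * H t * norm h"
      using h c by (simp add: H_def Ra_def Rf_def h_def[symmetric] field_simps)
    finally have "norm \<rho> \<le> H t * norm h"
      using c by simp
    then show "norm (u t - u x - D (t - x)) / norm (t - x) \<le> H t"
      using h by (simp add: \<rho>_def \<delta>_def h_def divide_le_eq)
  next
    have "(Ra \<longlongrightarrow> 0) (at x within S)" "(Rf \<longlongrightarrow> 0) (at x within S)"
      using a f by (auto simp: has_derivative_iff_norm Ra_def[abs_def] Rf_def[abs_def])
    \<comment> \<open>The factor \<open>Ra t + K\<close> is only bounded in the limit; its product
      with \<open>norm (\<delta> t)\<close> vanishes by the continuity of \<open>u\<close> shown
      above.\<close>
    then have "(H \<longlongrightarrow> (0 + 0 * norm (u x) + (0 + K) * norm (0 :: 'v)) / c) (at x within S)"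
      unfolding H_def[abs_def] using c by (intro tendsto_intros \<delta>_cont) auto
    then show "(H \<longlongrightarrow> 0) (at x within S)"
      by simp
  qed
  then show ?thesis
    by (auto simp: differentiable_def)
qed

section \<open>Passing from forms to bounded operators, and from Galerkin solutions to the data
  misfit\<close>

text \<open>\<open>form_blinfun\<close> applies \<open>Blinfun\<close> twice, so boundedness has to
  be verified at both levels before evaluation returns the original form.\<close>

lemma form_blinfun_apply:
  fixes a :: "'v::real_normed_vector \<Rightarrow> 'v \<Rightarrow> real" and w v :: 'v
  assumes a: "bilinear a" and le: "\<And>w v. a w v \<le> \<gamma> * norm w * norm v"
  shows "form_blinfun a w v = a w v"
proof -
  \<comment> \<open>The one-sided bound becomes two-sided when \<open>v\<close> is replaced by
    \<open>- v\<close>.\<close>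
  have abs_le: "\<bar>a w v\<bar> \<le> \<gamma> * norm w * norm v" for w v
    using le[of w v] le[of w "- v"] by (simp add: bilinear_rneg[OF a])
  have 1: "bounded_linear (a w)" for w
    using a abs_le[of w] unfolding bilinear_def
    by (intro bounded_linear.intro bounded_linear_axioms.intro exI[of _ "\<gamma> * norm w"])
      (auto simp: mult.commute)
  \<comment> \<open>The operator norm bound requires a nonnegative constant, and the sign of
    \<open>\<gamma>\<close> is not known here; hence the absolute value.\<close>
  have bound: "norm (Blinfun (a w)) \<le> \<bar>\<gamma>\<bar> * norm w" for w
  proof (intro norm_blinfun_bound)
    fix v
    have "norm (a w v) \<le> \<gamma> * (norm w * norm v)"
      using abs_le[of w v] by (simp add: mult.assoc)
    also have "\<dots> \<le> \<bar>\<gamma>\<bar> * (norm w * norm v)"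
      by (intro mult_right_mono) auto
    finally show "norm (blinfun_apply (Blinfun (a w)) v) \<le> \<bar>\<gamma>\<bar> * norm w * norm v"
      by (simp add: bounded_linear_Blinfun_apply[OF 1] mult.assoc)
  qed simp
  have "bounded_linear (\<lambda>w. Blinfun (a w))"
  proof (rule bounded_linear_intro)
    show "Blinfun (a (w + w')) = Blinfun (a w) + Blinfun (a w')" for w w'
      by (rule blinfun_eqI)
        (simp add: bounded_linear_Blinfun_apply[OF 1] blinfun.add_left bilinear_ladd[OF a])
    show "Blinfun (a (r *\<^sub>R w)) = r *\<^sub>R Blinfun (a w)" for r w
      by (rule blinfun_eqI)
        (simp add: bounded_linear_Blinfun_apply[OF 1] blinfun.scaleR_left bilinear_lmul[OF a])
    show "norm (Blinfun (a w)) \<le> norm w * \<bar>\<gamma>\<bar>" for w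
      using bound[of w] by (simp add: mult.commute)
  qed
  then show ?thesis
    by (simp add: form_blinfun_def bounded_linear_Blinfun_apply 1)
qed

text \<open>The residual is affine in \<open>u\<close> with bounded linear components, and the
  misfit is a quadratic form in the residual. Differentiability of the residual is checked
  coordinate by coordinate.\<close>

lemma misfit_differentiable:
  fixes \<Gamma> :: "real^'s^'s"
  assumes "u differentiable (at x within S)"
  shows "(\<lambda>t. misfit obs \<Gamma> y (u t)) differentiable (at x within S)"
proof -
  obtain u' where u': "(u has_derivative u') (at x within S)"
    using assms by (auto simp: differentiable_def)
  have "(\<lambda>t. y - (\<chi> i. blinfun_apply (obs i) (u t))) differentiable (at x within S)"
  proof (rule differentiable_componentwise_within[THEN iffD2], rule ballI)
    fix b :: "real^'s" assume "b \<in> Basis"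
    then obtain j where "b = axis j 1"
      by (auto simp: Basis_vec_def)
    moreover have "(\<lambda>t. y $ j - blinfun_apply (obs j) (u t)) differentiable (at x within S)"
      using bounded_linear.has_derivative[OF blinfun.bounded_linear_right u', of "obs j"]
      by (intro differentiable_diff differentiable_const differentiableI)
    ultimately show "(\<lambda>t. (y - (\<chi> i. blinfun_apply (obs i) (u t))) \<bullet> b) differentiable
        (at x within S)"
      by (simp add: inner_axis)
  qed
  then obtain r' where r: "((\<lambda>t. y - (\<chi> i. blinfun_apply (obs i) (u t))) has_derivative r')
      (at x within S)"
    by (auto simp: differentiable_def)
  note Mr = bounded_linear.has_derivative[OF matrix_vector_mul_bounded_linear r, of "matrix_inv \<Gamma>"]
  show ?thesis
    unfolding misfit_def Let_def
    using has_derivative_mult_right[OF has_derivative_inner[OF r Mr], of "1/2"]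
    by (rule differentiableI)
qed

text \<open>Stated for any subspace of a finite-dimensional span, so that it covers both the full
  space and the reduced space.\<close>

lemma galerkin_misfit_differentiable:
  fixes A :: "real^'d \<Rightarrow> 'v::real_inner \<Rightarrow> 'v \<Rightarrow> real"
  assumes bilinear: "\<And>\<theta>. \<theta> \<in> \<Theta> \<Longrightarrow> bilinear (A \<theta>)"
    and A1: "coercive_continuous A F \<Theta>" and A2: "smooth_parametric A F \<Theta>"
    and W: "subspace W" "W \<subseteq> span B" "finite B"
    and u: "\<And>\<theta>. \<theta> \<in> \<Theta> \<Longrightarrow> galerkin_solution (A \<theta>) (F \<theta>) W (u \<theta>)"
    and \<theta>: "\<theta> \<in> \<Theta>"
  shows "(\<lambda>t. misfit obs \<Gamma> y (u t)) differentiable (at \<theta> within \<Theta>)"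
proof -
  define a where "a = (\<lambda>\<theta>. form_blinfun (A \<theta>))"
  define f where "f = (\<lambda>\<theta>. Blinfun (F \<theta>))"
  obtain a' f' where a': "(a has_derivative a') (at \<theta> within \<Theta>)"
    and f': "(f has_derivative f') (at \<theta> within \<Theta>)"
    using A2 \<theta> unfolding smooth_parametric_def C1_on_def a_def f_def by blast
  have a: "a t w v = A t w v" if "t \<in> \<Theta>" for t w v
    using A1 that form_blinfun_apply[OF bilinear[OF that]]
    unfolding coercive_continuous_def a_def by meson
  have f: "f t v = F t v" if "t \<in> \<Theta>" for t v
    using A1 that by (simp add: coercive_continuous_def f_def bounded_linear_Blinfun_apply)
  obtain c where c: "c > 0" "\<And>w. c * (norm w)\<^sup>2 \<le> a \<theta> w w"
    using A1 \<theta> a[OF \<theta>] unfolding coercive_continuous_def by metis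
  have "u differentiable (at \<theta> within \<Theta>)"
    using u by (intro galerkin_differentiable[OF W c(2,1) \<theta> a' f'])
      (auto simp: galerkin_solution_def a f)
  then show ?thesis
    by (rule misfit_differentiable)
qed

section \<open>The sample error in terms of the gradient of the potential error\<close>

text \<open>The constants are quantified before the reduced space, the reduced solution and its
  samples. They may depend on the full-order samples but are uniform over all reductions; otherwise
  they could be chosen to fit the error.\<close>

theorem theoremA4:
  fixes A :: "real^'d \<Rightarrow> 'v::{real_inner, complete_space} \<Rightarrow> 'v \<Rightarrow> real"
    and F :: "real^'d \<Rightarrow> 'v \<Rightarrow> real"
    and \<Theta> :: "(real^'d) set"
    and p0 :: "real^'d \<Rightarrow> real"
    and obs :: "'s::finite \<Rightarrow> 'v \<Rightarrow>\<^sub>L real"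
    and \<Gamma> :: "real^'s^'s"
    and y :: "real^'s"
    and V\<^sub>h :: "'v set"
    and u\<^sub>h :: "real^'d \<Rightarrow> 'v"
    and C\<^sub>p C\<^sub>\<eta> \<kappa> :: real
    and M l :: nat
    and \<alpha>\<^sub>h :: "nat \<Rightarrow> real"
    and \<theta>0 :: "nat \<Rightarrow> real^'d"
    and \<theta>\<^sub>h :: "nat \<Rightarrow> nat \<Rightarrow> real^'d"
  assumes "unique_derivatives \<Theta>"
    and "prior_density p0 \<Theta>"
    and "\<And>\<theta>. \<theta> \<in> \<Theta> \<Longrightarrow> bilinear (A \<theta>)"
    and "\<And>\<theta>. \<theta> \<in> \<Theta> \<Longrightarrow> linear (F \<theta>)"
    and A1: "coercive_continuous A F \<Theta>"
    and A2: "smooth_parametric A F \<Theta>"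
    and "symmetric_pos_def \<Gamma>"
    and "subspace V\<^sub>h" "\<exists>B. finite B \<and> V\<^sub>h = span B"
    and "\<And>\<theta>. \<theta> \<in> \<Theta> \<Longrightarrow> galerkin_solution (A \<theta>) (F \<theta>) V\<^sub>h (u\<^sub>h \<theta>)"
    and L1: "\<And>\<theta> \<theta>'. \<theta> \<in> \<Theta> \<Longrightarrow> \<theta>' \<in> \<Theta> \<Longrightarrow>
      norm1 (score_prior \<Theta> p0 \<theta> - score_prior \<Theta> p0 \<theta>') \<le> C\<^sub>p * norm1 (\<theta> - \<theta>')"
    and L2: "\<And>\<theta> \<theta>'. \<theta> \<in> \<Theta> \<Longrightarrow> \<theta>' \<in> \<Theta> \<Longrightarrow>
      norm1 (grad_within \<Theta> (\<lambda>t. misfit obs \<Gamma> y (u\<^sub>h t)) \<theta>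
             - grad_within \<Theta> (\<lambda>t. misfit obs \<Gamma> y (u\<^sub>h t)) \<theta>') \<le> C\<^sub>\<eta> * norm1 (\<theta> - \<theta>')"
    and "\<kappa> > 0" and "M \<ge> 1" and "\<And>i. \<alpha>\<^sub>h i > 0"
    and "svgd_samples \<kappa> M \<alpha>\<^sub>h (score_posterior \<Theta> p0 (\<lambda>t. misfit obs \<Gamma> y (u\<^sub>h t))) \<theta>\<^sub>h"
    and "\<And>n. n \<in> {1..M} \<Longrightarrow> \<theta>\<^sub>h 0 n = \<theta>0 n"
    and "\<And>i n. n \<in> {1..M} \<Longrightarrow> \<theta>\<^sub>h i n \<in> \<Theta>"
  shows "\<exists>C :: nat \<Rightarrow> real. \<forall>V\<^sub>r u\<^sub>r \<alpha>\<^sub>r \<theta>\<^sub>r.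
    subspace V\<^sub>r \<longrightarrow> V\<^sub>r \<subseteq> V\<^sub>h \<longrightarrow>
    (\<forall>\<theta>\<in>\<Theta>. galerkin_solution (A \<theta>) (F \<theta>) V\<^sub>r (u\<^sub>r \<theta>)) \<longrightarrow>
    (\<forall>i. \<alpha>\<^sub>r i > 0) \<longrightarrow> (\<forall>i\<in>{0..l}. \<alpha>\<^sub>h i = \<alpha>\<^sub>r i) \<longrightarrow>
    svgd_samples \<kappa> M \<alpha>\<^sub>r (score_posterior \<Theta> p0 (\<lambda>t. misfit obs \<Gamma> y (u\<^sub>r t))) \<theta>\<^sub>r \<longrightarrow>
    (\<forall>n\<in>{1..M}. \<theta>\<^sub>r 0 n = \<theta>0 n) \<longrightarrow>
    (\<forall>i. \<forall>n\<in>{1..M}. \<theta>\<^sub>r i n \<in> \<Theta>) \<longrightarrow>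
    (\<forall>n\<in>{1..M}. norm1 (\<theta>\<^sub>h (Suc l) n - \<theta>\<^sub>r (Suc l) n) \<le>
       (\<Sum>i=0..l. C i * ((1 / real M) * (\<Sum>m=1..M. norm1 (grad_within \<Theta>
          (\<lambda>t. misfit obs \<Gamma> y (u\<^sub>h t) - misfit obs \<Gamma> y (u\<^sub>r t)) (\<theta>\<^sub>r i m))))))"
proof -
  define \<eta>\<^sub>h where "\<eta>\<^sub>h = (\<lambda>t. misfit obs \<Gamma> y (u\<^sub>h t))"
  define s where "s = score_posterior \<Theta> p0 \<eta>\<^sub>h"
  obtain B where B: "finite B" "V\<^sub>h = span B"
    using assms(9) by blast
  \<comment> \<open>Absolute values are taken because the perturbation lemma needs a nonnegative
    Lipschitz constant, and the signs of \<open>C\<^sub>\<eta>\<close> and \<open>C\<^sub>p\<close>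
    are not prescribed.\<close>
  have lip: "norm1 (s t - s t') \<le> (\<bar>C\<^sub>\<eta>\<bar> + \<bar>C\<^sub>p\<bar>) * norm1 (t - t')" if t: "t \<in> \<Theta>" "t' \<in> \<Theta>" for t t'
  proof -
    have split: "s t - s t' = (score_prior \<Theta> p0 t - score_prior \<Theta> p0 t')
        - (grad_within \<Theta> \<eta>\<^sub>h t - grad_within \<Theta> \<eta>\<^sub>h t')"
      by (simp add: s_def score_posterior_def)
    have "norm1 (s t - s t') \<le> C\<^sub>p * norm1 (t - t') + C\<^sub>\<eta> * norm1 (t - t')"
      using L1[OF t] L2[OF t] unfolding split \<eta>\<^sub>h_def by (rule order_trans[OF norm1_diff_le add_mono])
    also have "\<dots> = (C\<^sub>\<eta> + C\<^sub>p) * norm1 (t - t')"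
      by (simp add: algebra_simps)
    also have "\<dots> \<le> (\<bar>C\<^sub>\<eta>\<bar> + \<bar>C\<^sub>p\<bar>) * norm1 (t - t')"
      by (intro mult_right_mono norm1_nonneg) auto
    finally show ?thesis .
  qed
  \<comment> \<open>The step indices \<open>0, ..., l\<close> are those below \<open>Suc l\<close>,
    so the perturbation lemma is taken at \<open>k = Suc l\<close>.\<close>
  have "\<exists>C. \<forall>s' \<beta> z. (\<forall>i<Suc l. \<alpha>\<^sub>h i = \<beta> i) \<longrightarrow> svgd_samples \<kappa> M \<beta> s' z \<longrightarrow>
    (\<forall>n\<in>{1..M}. z 0 n = \<theta>\<^sub>h 0 n) \<longrightarrow> (\<forall>i. \<forall>n\<in>{1..M}. z i n \<in> \<Theta>) \<longrightarrow>
    (\<forall>n\<in>{1..M}. norm1 (\<theta>\<^sub>h (Suc l) n - z (Suc l) n)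
      \<le> (\<Sum>i<Suc l. C i * ((1 / real M) * (\<Sum>m=1..M. norm1 (s (z i m) - s' (z i m))))))"
    using assms(13-16) lip assms(18) unfolding \<eta>\<^sub>h_def[symmetric] s_def[symmetric]
    by (intro svgd_samples_perturbation[where L = "\<bar>C\<^sub>\<eta>\<bar> + \<bar>C\<^sub>p\<bar>"]) auto
  then obtain C where C: "\<And>s' \<beta> z n. \<lbrakk>\<forall>i<Suc l. \<alpha>\<^sub>h i = \<beta> i; svgd_samples \<kappa> M \<beta> s' z;
      \<forall>n\<in>{1..M}. z 0 n = \<theta>\<^sub>h 0 n; \<forall>i. \<forall>n\<in>{1..M}. z i n \<in> \<Theta>; n \<in> {1..M}\<rbrakk> \<Longrightarrow>
      norm1 (\<theta>\<^sub>h (Suc l) n - z (Suc l) n)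
      \<le> (\<Sum>i<Suc l. C i * ((1 / real M) * (\<Sum>m=1..M. norm1 (s (z i m) - s' (z i m)))))"
    by blast
  show ?thesis
  proof (intro exI allI impI ballI)
    fix V\<^sub>r u\<^sub>r \<alpha>\<^sub>r \<theta>\<^sub>r n
    assume V\<^sub>r: "subspace V\<^sub>r" "V\<^sub>r \<subseteq> V\<^sub>h"
      and u\<^sub>r: "\<forall>\<theta>\<in>\<Theta>. galerkin_solution (A \<theta>) (F \<theta>) V\<^sub>r (u\<^sub>r \<theta>)"
      and \<alpha>: "\<forall>i\<in>{0..l}. \<alpha>\<^sub>h i = \<alpha>\<^sub>r i"
      and \<theta>\<^sub>r: "svgd_samples \<kappa> M \<alpha>\<^sub>r (score_posterior \<Theta> p0 (\<lambda>t. misfit obs \<Gamma> y (u\<^sub>r t))) \<theta>\<^sub>r"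
        "\<forall>n\<in>{1..M}. \<theta>\<^sub>r 0 n = \<theta>0 n" "\<forall>i. \<forall>n\<in>{1..M}. \<theta>\<^sub>r i n \<in> \<Theta>"
      and n: "n \<in> {1..M}"
    define \<eta>\<^sub>r where "\<eta>\<^sub>r = (\<lambda>t. misfit obs \<Gamma> y (u\<^sub>r t))"
    define s' where "s' = score_posterior \<Theta> p0 \<eta>\<^sub>r"
    \<comment> \<open>The prior score cancels. Differentiability of both potentials is what allows
      the difference of their gradients to be written as the gradient of their difference.\<close>
    have score_diff: "norm1 (s t - s' t) = norm1 (grad_within \<Theta> (\<lambda>t. \<eta>\<^sub>h t - \<eta>\<^sub>r t) t)"
      if t: "t \<in> \<Theta>" for t
    proof -
      have "\<eta>\<^sub>h differentiable (at t within \<Theta>)"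
        unfolding \<eta>\<^sub>h_def using assms(3,8,10) B t
        by (intro galerkin_misfit_differentiable[OF _ A1 A2, of V\<^sub>h B]) auto
      moreover have "\<eta>\<^sub>r differentiable (at t within \<Theta>)"
        \<comment> \<open>The finite set \<open>B\<close> spanning \<open>V\<^sub>h\<close> serves
          again, as \<open>V\<^sub>r\<close> lies inside \<open>V\<^sub>h\<close>.\<close>
        unfolding \<eta>\<^sub>r_def using assms(3) V\<^sub>r u\<^sub>r B t
        by (intro galerkin_misfit_differentiable[OF _ A1 A2, of V\<^sub>r B]) auto
      ultimately have "s t - s' t = - grad_within \<Theta> (\<lambda>t. \<eta>\<^sub>h t - \<eta>\<^sub>r t) t"
        by (simp add: grad_within_diff[OF assms(1) t] s_def s'_def score_posterior_def)
      then show ?thesis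
        by (simp only: norm1_minus)
    qed
    have "norm1 (\<theta>\<^sub>h (Suc l) n - \<theta>\<^sub>r (Suc l) n)
        \<le> (\<Sum>i<Suc l. C i * ((1 / real M) * (\<Sum>m=1..M. norm1 (s (\<theta>\<^sub>r i m) - s' (\<theta>\<^sub>r i m)))))"
      using \<alpha> \<theta>\<^sub>r assms(17) n by (intro C) (auto simp: s'_def \<eta>\<^sub>r_def less_Suc_eq_le)
    also have "\<dots> = (\<Sum>i=0..l. C i * ((1 / real M) * (\<Sum>m=1..M.
        norm1 (grad_within \<Theta> (\<lambda>t. \<eta>\<^sub>h t - \<eta>\<^sub>r t) (\<theta>\<^sub>r i m)))))"
      using \<theta>\<^sub>r(3) score_diff by (simp add: atLeast0AtMost lessThan_Suc_atMost)
    finally show "norm1 (\<theta>\<^sub>h (Suc l) n - \<theta>\<^sub>r (Suc l) n) \<le>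
       (\<Sum>i=0..l. C i * ((1 / real M) * (\<Sum>m=1..M. norm1 (grad_within \<Theta>
          (\<lambda>t. misfit obs \<Gamma> y (u\<^sub>h t) - misfit obs \<Gamma> y (u\<^sub>r t)) (\<theta>\<^sub>r i m)))))"
      by (simp only: \<eta>\<^sub>h_def \<eta>\<^sub>r_def)
  qed
qed

end
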